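(* For any positive integers $n,k$ with $n\ge 2k$, $$\vec{\chi}(KG(n,k)) \ge \left\lfloor \frac{n-2k+2}{8\log_2(n/k)} \right\rfloor.$$
   Context: The Kneser graph $KG(n,k)$ is the graph whose vertices are the $k$-element subsets of a set with $n$ elements, two vertices being adjacent if the corresponding sets are disjoint. For a digraph $D$, a vertex-set is acyclic if the subdigraph it induces contains no directed cycle. The chromatic number $\chi(D)$ is the minimum number of acyclic vertex-sets whose union is $V(D)$. An orientation of an undirected graph $G$ is a digraph obtained by choosing exactly one direction for each edge of $G$. The dichromatic number $\vec{\chi}(G)$ is the maximum of $\chi(D)$ over all orientations $D$ of $G$. *)

theory Defs
  imports
    "HOL.Transcendental"
    "HOL-Library.Ramsey"
    "Graph_Theory.Graph_Theory"
begin

text \<open>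
  As in \<^theory>\<open>Graph_Theory.Digraph\<close>, an undirected graph is a symmetric digraph without
  loops or parallel arcs: an edge is represented by its two opposite arcs.
\<close>

definition kneser_graph :: "'a set \<Rightarrow> nat \<Rightarrow> 'a set pair_pre_digraph" where
  "kneser_graph X k =
     \<lparr> pverts = nsets X k,
       parcs = {(A, B). A \<in> nsets X k \<and> B \<in> nsets X k \<and> A \<inter> B = {}} \<rparr>"

definition acyclic_vertex_set :: "('a, 'b) pre_digraph \<Rightarrow> 'a set \<Rightarrow> bool" where
  "acyclic_vertex_set D S \<longleftrightarrow>
     S \<subseteq> verts D \<and> \<not> (\<exists>p. pre_digraph.cycle (D \<restriction> S) p)"

definition digraph_chromatic_number :: "('a, 'b) pre_digraph \<Rightarrow> nat" where
  "digraph_chromatic_number D =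
     (LEAST c. \<exists>\<S>. finite \<S> \<and> card \<S> = c \<and>
        (\<forall>S\<in>\<S>. acyclic_vertex_set D S) \<and> \<Union>\<S> = verts D)"

definition orientation :: "'a pair_pre_digraph \<Rightarrow> 'a pair_pre_digraph \<Rightarrow> bool" where
  "orientation D G \<longleftrightarrow>
     pverts D = pverts G \<and> parcs D \<subseteq> parcs G \<and>
     (\<forall>u v. (u, v) \<in> parcs G \<longrightarrow> ((u, v) \<in> parcs D) \<noteq> ((v, u) \<in> parcs D))"

text \<open>
  The maximum is meaningful for finite loopfree graphs, where the set of orientations is finite
  and nonempty (\<open>finite_orientations\<close> and \<open>ex_orientation\<close> below).
\<close>

definition dichromatic_number :: "'a pair_pre_digraph \<Rightarrow> nat" where
  "dichromatic_number G =
     Max ((\<lambda>D. digraph_chromatic_number (with_proj D)) ` {D. orientation D G})"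

lemma pair_graph_kneser_graph:
  assumes "finite X" "k > 0"
  shows "pair_graph (kneser_graph X k)"
proof
  have fin: "finite (nsets X k)"
    using assms by (simp add: finite_imp_finite_nsets)
  show "finite (pverts (kneser_graph X k))"
    using fin by (simp add: kneser_graph_def)
  show "finite (parcs (kneser_graph X k))"
    by (rule finite_subset[of _ "nsets X k \<times> nsets X k"]) (auto simp: kneser_graph_def fin)
  show "fst e \<in> pverts (kneser_graph X k)" "snd e \<in> pverts (kneser_graph X k)"
    if "e \<in> parcs (kneser_graph X k)" for e
    using that by (auto simp: kneser_graph_def)
  show "fst e \<noteq> snd e" if "e \<in> parcs (kneser_graph X k)" for e
  proof
    assume eq: "fst e = snd e"
    have "fst e \<in> nsets X k" "fst e \<inter> snd e = {}"
      using that by (simp_all add: kneser_graph_def case_prod_beta)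
    with eq have "card (fst e) = k" "fst e = {}"
      by (simp_all add: nsets_def)
    with assms show False
      by simp
  qed
  show "symmetric (with_proj (kneser_graph X k))"
    by (simp add: symmetric_def sym_def kneser_graph_def Int_commute)
qed

lemma finite_orientations:
  assumes "pair_graph G"
  shows "finite {D. orientation D G}"
proof -
  interpret pair_graph G by fact
  have "{D. orientation D G} \<subseteq> (\<lambda>R. \<lparr> pverts = pverts G, parcs = R \<rparr>) ` Pow (parcs G)"
  proof
    fix D assume "D \<in> {D. orientation D G}"
    then show "D \<in> (\<lambda>R. \<lparr> pverts = pverts G, parcs = R \<rparr>) ` Pow (parcs G)"
      by (cases D) (auto simp: orientation_def)
  qed
  then show ?thesis
    by (rule finite_subset) (simp add: pair_finite_arcs)
qed

lemma ex_orientation: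
  assumes "pair_graph G"
  shows "\<exists>D. orientation D G"
proof -
  interpret pair_graph G by fact
  obtain f :: "'a \<Rightarrow> nat" where f: "inj_on f (pverts G)"
    using finite_imp_inj_to_nat_seg[OF pair_finite_verts] by auto
  let ?D = "\<lparr> pverts = pverts G, parcs = {(u, v) \<in> parcs G. f u < f v} \<rparr>"
  have "((u, v) \<in> parcs ?D) \<noteq> ((v, u) \<in> parcs ?D)" if uv: "(u, v) \<in> parcs G" for u v
  proof -
    have "(v, u) \<in> parcs G"
      using uv sym_arcs by (auto simp: symmetric_def sym_def)
    moreover have "f u \<noteq> f v"
      using inj_onD[OF f _ in_arcsD1[OF uv] in_arcsD2[OF uv]] no_loops'[OF uv] by blast
    ultimately show ?thesis
      using uv by auto
  qed
  then have "orientation ?D G"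
    unfolding orientation_def by auto
  then show ?thesis ..
qed

lemma dichromatic_number_attained:
  assumes "pair_graph G"
  obtains D where "orientation D G"
    "digraph_chromatic_number (with_proj D) = dichromatic_number G"
proof -
  have "dichromatic_number G
      \<in> (\<lambda>D. digraph_chromatic_number (with_proj D)) ` {D. orientation D G}"
    unfolding dichromatic_number_def
    using finite_orientations[OF assms] ex_orientation[OF assms] by (intro Max_in) auto
  then show ?thesis
    using that by auto
qed

lemma acyclic_vertex_set_singleton:
  assumes "loopfree_digraph D" "v \<in> verts D"
  shows "acyclic_vertex_set D {v}"
proof -
  interpret loopfree_digraph D by fact
  have "arcs (D \<restriction> {v}) = {}"
    by (auto dest: no_loops)
  then have "\<not> pre_digraph.cycle (D \<restriction> {v}) p" for p
    by (simp add: pre_digraph.cycle_def pre_digraph.awalk_def del: induce_subgraph_arcs)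
  then show ?thesis
    using assms by (simp add: acyclic_vertex_set_def)
qed

lemma digraph_chromatic_number_attained:
  assumes "loopfree_digraph D" "finite (verts D)"
  obtains \<S> where "finite \<S>" "card \<S> = digraph_chromatic_number D"
    "\<And>S. S \<in> \<S> \<Longrightarrow> acyclic_vertex_set D S" "\<Union>\<S> = verts D"
proof -
  have "\<exists>c \<S>. finite \<S> \<and> card \<S> = c \<and> (\<forall>S\<in>\<S>. acyclic_vertex_set D S) \<and> \<Union>\<S> = verts D"
    by (rule exI, rule exI[of _ "(\<lambda>v. {v}) ` verts D"])
      (use assms acyclic_vertex_set_singleton in auto)
  from LeastI_ex[OF this] show ?thesis
    using that unfolding digraph_chromatic_number_def by blast
qed

end

theory Submission
  imports Defs
begin

text \<open>
  Let \<open>L = log 2 (n / k)\<close>, let \<open>N = n choose k\<close> be the number of vertices and suppose that the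
  digraph is covered by \<open>c\<close> acyclic sets. Two facts about \<^emph>\<open>bicliques\<close>, that is, pairs of sets of
  \<open>a\<close> vertices with all edges between them, contradict each other when \<open>c\<close> is small.

  On the one hand, a counting argument gives an orientation in which no acyclic set contains a biclique,
  provided that \<open>a\<close> exceeds \<open>2 * log 2 N + 2\<close>: an acyclic orientation of a biclique is
  determined by a topological order of its \<open>2 * a\<close> vertices and fixes the direction of \<open>a * a\<close>
  edges, so the \<open>(2 * N)\<^bsup>2 * a\<^esup>\<close> possibilities do not exhaust all orientations
  (\<open>orientation_with_acyclic_sets_biclique_free\<close>).

  On the other hand, any cover of the Kneser graph by few sets has a member with a large biclique
  (\<open>kneser_cover_contains_biclique\<close>). Colour each \<open>(k + m)\<close>-set \<open>Y\<close> by a member of the cover that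
  contains at least the average number \<open>((k + m) choose k) / c\<close> of \<open>k\<close>-subsets of \<open>Y\<close>. This colours
  the vertices of the Kneser graph of \<open>(k + m)\<close>-sets, and by the theorem of Lovasz a proper colouring
  needs \<open>n - 2 * (k + m) + 2\<close> colours. With fewer colours, two disjoint \<open>(k + m)\<close>-sets have the same
  colour, and their \<open>k\<close>-subsets in this member of the cover form a biclique.

  If \<open>c\<close> is smaller than the claimed bound, \<open>m\<close> can be chosen as almost half of \<open>n - 2 * k + 2\<close>, and
  then \<open>((k + m) choose k) / c\<close> is larger than \<open>2 * log 2 N + 2\<close> (\<open>cover_size_times_log_less_choose\<close>).

  The theorem of Lovasz (\<open>Lovasz_Kneser\<close>) is derived, following Matousek, from Tucker's lemma for
  the cross-polytope (\<open>octahedral_Tucker\<close>): an antipodal labelling of the nonzero sign vectors of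
  length \<open>n\<close> by \<open>\<plusminus>1, \<dots>, \<plusminus>(n - 1)\<close> has two comparable sign vectors with complementary labels. Tucker's
  lemma itself is a parity argument: without such a pair, the suitably labelled facets of chains of sign
  vectors cancel in pairs, except for the one at the centre of the cross-polytope.
\<close>

section \<open>Labellings of the cross-polytope\<close>

lemma even_card_fixed_point_free_involution:
  assumes "finite A"
    and "\<And>x. x \<in> A \<Longrightarrow> f x \<in> A \<and> f (f x) = x \<and> f x \<noteq> x"
  shows "even (card A)"
  using assms
proof (induction A rule: finite_psubset_induct)
  case (psubset A)
  show ?case
  proof (cases "A = {}")
    case False
    then obtain x where x: "x \<in> A" by auto
    let ?B = "A - {x, f x}"
    have fx: "f x \<in> A" "f (f x) = x" "f x \<noteq> x"
      using psubset.prems[OF x] by auto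
    have "even (card ?B)"
    proof (rule psubset.IH)
      show "?B \<subset> A" using x by auto
      show "f y \<in> ?B \<and> f (f y) = y \<and> f y \<noteq> y" if "y \<in> ?B" for y
        using that psubset.prems[of y] fx by (metis Diff_iff insert_iff empty_iff)
    qed
    moreover have "card A = card ?B + card {x, f x}"
      using x fx psubset.hyps
      by (metis card_Diff_subset card_mono empty_subsetI finite.emptyI finite_insert
          insert_subset le_add_diff_inverse2)
    ultimately show ?thesis using fx by simp
  qed simp
qed

text \<open>
  A set of integers stands for a vector in \<open>{+, -, 0}\<^sup>n\<close>: the element \<open>i > 0\<close> says that
  coordinate \<open>i\<close> is positive, \<open>- i\<close> that it is negative. Nonempty sign vectors are the faces of the
  \<open>n\<close>-dimensional cross-polytope, inclusion is the face order, and a labelling by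
  \<open>\<plusminus>1, \<dots>, \<plusminus>n\<close> turns a chain of faces into a set that can be compared with the faces themselves.
\<close>
definition sign_vectors :: "nat \<Rightarrow> int set set" where
  "sign_vectors n = {A. A \<subseteq> {- int n..int n} \<and> (\<forall>x\<in>A. - x \<notin> A)}"

lemma sign_vectors_subset: "A \<in> sign_vectors n \<Longrightarrow> B \<subseteq> A \<Longrightarrow> B \<in> sign_vectors n"
  by (auto simp: sign_vectors_def)

lemma sign_vectors_uminus: "A \<in> sign_vectors n \<Longrightarrow> uminus ` A \<in> sign_vectors n"
  by (auto simp: sign_vectors_def)

lemma sign_vectors_finite: "A \<in> sign_vectors n \<Longrightarrow> finite A"
  by (auto simp: sign_vectors_def intro: finite_subset)

text \<open>
  The maximal chains \<open>{} = A\<^sub>0 \<subset> A\<^sub>1 \<subset> \<dots> \<subset> A\<^sub>s\<close> below a sign vector \<open>A\<^sub>s\<close>, each recorded as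
  the list of the elements in the order in which they are added. The empty set is the centre of the
  cross-polytope.
\<close>
definition maximal_chains :: "nat \<Rightarrow> int list set" where
  "maximal_chains n = {xs. distinct xs \<and> set xs \<in> sign_vectors n}"

lemma finite_maximal_chains: "finite (maximal_chains n)"
proof (rule finite_subset)
  show "maximal_chains n \<subseteq> {xs. set xs \<subseteq> {- int n..int n} \<and> length xs \<le> card {- int n..int n}}"
  proof
    fix xs assume "xs \<in> maximal_chains n"
    then have "distinct xs" "set xs \<subseteq> {- int n..int n}"
      by (auto simp: maximal_chains_def sign_vectors_def)
    moreover from this have "length xs \<le> card {- int n..int n}"
      by (metis card_mono distinct_card finite_atLeastAtMost_int)
    ultimately show "xs \<in> {xs. set xs \<subseteq> {- int n..int n} \<and> length xs \<le> card {- int n..int n}}"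
      by blast
  qed
qed (rule finite_lists_length_le, simp)

definition chain_labels :: "(int set \<Rightarrow> int) \<Rightarrow> int list \<Rightarrow> nat \<Rightarrow> int" where
  "chain_labels l xs j = l (set (take j xs))"

text \<open>
  The incidences between a maximal chain and one of its facets (the chain without its \<open>i\<close>-th member)
  for which the labels on the facet are exactly the elements of the top \<open>A\<^sub>s\<close> of the chain. As \<open>s\<close>
  facet members carry \<open>s\<close> labels, no label is repeated on the facet.
\<close>
definition doors :: "nat \<Rightarrow> (int set \<Rightarrow> int) \<Rightarrow> (int list \<times> nat) set" where
  "doors n l = {(xs, i). xs \<in> maximal_chains n \<and> i \<le> length xs \<and>
     chain_labels l xs ` ({..length xs} - {i}) = set xs}"

lemma finite_doors: "finite (doors n l)"
proof -
  have "doors n l \<subseteq> (SIGMA xs : maximal_chains n. {..length xs})"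
    by (auto simp: doors_def)
  then show ?thesis
    by (rule finite_subset) (simp add: finite_maximal_chains)
qed

lemma doors_inj_on:
  assumes "(xs, i) \<in> doors n l"
  shows "inj_on (chain_labels l xs) ({..length xs} - {i})"
proof (rule eq_card_imp_inj_on)
  have "card (set xs) = length xs"
    using assms by (auto simp: doors_def maximal_chains_def distinct_card)
  then show "card (chain_labels l xs ` ({..length xs} - {i})) = card ({..length xs} - {i})"
    using assms by (auto simp: doors_def)
qed simp

text \<open>
  When neither the bottom nor the top of a chain is missing, there are exactly two ways to fill the gap
  between \<open>A\<^bsub>i-1\<^esub>\<close> and \<open>A\<^bsub>i+1\<^esub>\<close>. Passing from one to the other exchanges two neighbouring list
  entries and changes neither the facet nor the top.
\<close>
lemma even_interior_doors: "even (card {(xs, i) \<in> doors n l. 0 < i \<and> i < length xs})"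
proof -
  define swap :: "int list \<times> nat \<Rightarrow> int list \<times> nat" where
    "swap = (\<lambda>(xs, i). (xs[i - 1 := xs ! i, i := xs ! (i - 1)], i))"
  show ?thesis
  proof (rule even_card_fixed_point_free_involution[where f = swap])
    show "finite {(xs, i) \<in> doors n l. 0 < i \<and> i < length xs}"
      by (rule finite_subset[OF _ finite_doors]) auto
    fix p assume "p \<in> {(xs, i) \<in> doors n l. 0 < i \<and> i < length xs}"
    then obtain xs i where p: "p = (xs, i)" and d: "(xs, i) \<in> doors n l" and i: "0 < i" "i < length xs"
      by auto
    let ?ys = "xs[i - 1 := xs ! i, i := xs ! (i - 1)]"
    have dist: "distinct xs" and sv: "set xs \<in> sign_vectors n"
      and lab: "chain_labels l xs ` ({..length xs} - {i}) = set xs"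
      using d by (auto simp: doors_def maximal_chains_def)
    \<comment> \<open>The exchange of entries \<open>i - 1\<close> and \<open>i\<close> is only visible in the prefix of length \<open>i\<close>.\<close>
    have prefix: "set (take j ?ys) = set (take j xs)" if "j \<noteq> i" for j
    proof (cases "j < i")
      case True
      then show ?thesis by (simp add: take_update_cancel)
    next
      case False
      then have j: "i < j" using that by simp
      have "take j ?ys = (take j xs)[i - 1 := take j xs ! i, i := take j xs ! (i - 1)]"
        using j i by (simp add: take_update_swap)
      also have "set \<dots> = set (take j xs)"
        using i j by (subst set_swap) auto
      finally show ?thesis .
    qed
    have "set ?ys = set xs" "distinct ?ys"
      using i dist by (auto simp: set_swap distinct_swap)
    moreover have "chain_labels l ?ys ` ({..length xs} - {i}) = chain_labels l xs ` ({..length xs} - {i})"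
      unfolding chain_labels_def using prefix by (intro image_cong) auto
    ultimately have "swap p \<in> doors n l"
      using lab sv i by (simp add: swap_def p doors_def maximal_chains_def)
    moreover have "swap (swap p) = p"
      using i by (auto simp: swap_def p list_eq_iff_nth_eq nth_list_update)
    moreover have "swap p \<noteq> p"
    proof
      assume "swap p = p"
      then have "?ys ! i = xs ! i" by (simp add: swap_def p)
      then have "xs ! (i - 1) = xs ! i" using i by simp
      then show False using i dist by (simp add: nth_eq_iff_index_eq)
    qed
    ultimately show "swap p \<in> {(xs, i) \<in> doors n l. 0 < i \<and> i < length xs} \<and> swap (swap p) = p \<and> swap p \<noteq> p"
      using i by (auto simp: swap_def p)
  qed
qed

text \<open>
  A facet that misses only the centre lies on the boundary of the cross-polytope, where the labelling
  is antipodal; so these facets come in antipodal pairs.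
\<close>
lemma even_boundary_doors:
  assumes odd: "\<And>A. A \<in> sign_vectors n \<Longrightarrow> A \<noteq> {} \<Longrightarrow> l (uminus ` A) = - l A"
  shows "even (card {(xs, i) \<in> doors n l. i = 0 \<and> xs \<noteq> []})"
proof (rule even_card_fixed_point_free_involution[where f = "\<lambda>(xs, i). (map uminus xs, i)"])
  show "finite {(xs, i) \<in> doors n l. i = 0 \<and> xs \<noteq> []}"
    by (rule finite_subset[OF _ finite_doors]) auto
  fix p assume "p \<in> {(xs, i) \<in> doors n l. i = 0 \<and> xs \<noteq> []}"
  then obtain xs where p: "p = (xs, 0)" and d: "(xs, 0) \<in> doors n l" and ne: "xs \<noteq> []"
    by auto
  have dist: "distinct xs" and sv: "set xs \<in> sign_vectors n"
    and lab: "chain_labels l xs ` ({..length xs} - {0}) = set xs"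
    using d by (auto simp: doors_def maximal_chains_def)
  have "chain_labels l (map uminus xs) j = - chain_labels l xs j" if "j \<noteq> 0" for j
  proof -
    have "set (take j xs) \<in> sign_vectors n"
      using sv by (rule sign_vectors_subset) (rule set_take_subset)
    then show ?thesis
      using that ne odd[of "set (take j xs)"] by (simp add: chain_labels_def take_map)
  qed
  then have "chain_labels l (map uminus xs) ` ({..length xs} - {0})
      = uminus ` chain_labels l xs ` ({..length xs} - {0})"
    by (auto simp: image_image intro!: image_cong)
  then have "(map uminus xs, 0) \<in> doors n l"
    using lab dist sign_vectors_uminus[OF sv]
    by (simp add: doors_def maximal_chains_def distinct_map inj_on_def)
  moreover have "map uminus xs \<noteq> xs"
  proof
    assume eq: "map uminus xs = xs"
    have "- hd xs = hd xs" using arg_cong[OF eq, of hd] ne by (simp add: hd_map)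
    moreover have "- hd xs \<notin> set xs" "hd xs \<in> set xs"
      using sv ne by (auto simp: sign_vectors_def)
    ultimately show False by simp
  qed
  ultimately show "(case p of (xs, i) \<Rightarrow> (map uminus xs, i)) \<in> {(xs, i) \<in> doors n l. i = 0 \<and> xs \<noteq> []} \<and>
      (case case p of (xs, i) \<Rightarrow> (map uminus xs, i) of (xs, i) \<Rightarrow> (map uminus xs, i)) = p \<and>
      (case p of (xs, i) \<Rightarrow> (map uminus xs, i)) \<noteq> p"
    using ne by (simp add: p comp_def)
qed

text \<open>
  If the labels of the chain are not all distinct, the label of the missing member occurs exactly once on
  the facet, and the member that carries it there can be removed instead.
\<close>
lemma even_repeated_doors:
  "even (card {(xs, i) \<in> doors n l. \<not> inj_on (chain_labels l xs) {..length xs}})"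
proof -
  define twin where
    "twin = (\<lambda>(xs, i). (xs :: int list,
        SOME j. j \<le> length xs \<and> j \<noteq> i \<and> chain_labels l xs j = chain_labels l xs i))"
  show ?thesis
  proof (rule even_card_fixed_point_free_involution[where f = twin])
    show "finite {(xs, i) \<in> doors n l. \<not> inj_on (chain_labels l xs) {..length xs}}"
      by (rule finite_subset[OF _ finite_doors]) auto
    fix p assume "p \<in> {(xs, i) \<in> doors n l. \<not> inj_on (chain_labels l xs) {..length xs}}"
    then obtain xs i where p: "p = (xs, i)" and d: "(xs, i) \<in> doors n l"
      and ninj: "\<not> inj_on (chain_labels l xs) {..length xs}"
      by auto
    let ?l = "chain_labels l xs" and ?J = "{..length xs}"
    have i: "i \<le> length xs" and lab: "?l ` (?J - {i}) = set xs"
      using d by (auto simp: doors_def)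
    have "?J = insert i (?J - {i})" using i by auto
    then have "?l i \<in> ?l ` (?J - {i})"
      using ninj doors_inj_on[OF d] inj_on_insert[of ?l i "?J - {i}"] by (metis Diff_idemp)
    then obtain j where j: "j \<le> length xs" "j \<noteq> i" "?l j = ?l i" by force
    have uniq_j: "j' = j" if "j' \<le> length xs \<and> j' \<noteq> i \<and> ?l j' = ?l i" for j'
      using inj_onD[OF doors_inj_on[OF d], of j' j] that j by auto
    have "(SOME j. j \<le> length xs \<and> j \<noteq> i \<and> ?l j = ?l i) = j"
      using j by (intro some_equality uniq_j) auto
    then have twin_p: "twin p = (xs, j)"
      by (simp add: twin_def p)
    have img: "?l ` (?J - {j}) = ?l ` (?J - {i})"
    proof (intro equalityI subsetI)
      fix y assume "y \<in> ?l ` (?J - {j})"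
      then obtain a where a: "a \<in> ?J - {j}" "y = ?l a" by blast
      show "y \<in> ?l ` (?J - {i})"
        by (cases "a = i") (use a j in \<open>auto intro: rev_image_eqI[of j]\<close>)
    next
      fix y assume "y \<in> ?l ` (?J - {i})"
      then obtain a where a: "a \<in> ?J - {i}" "y = ?l a" by blast
      show "y \<in> ?l ` (?J - {j})"
        by (cases "a = j") (use a j i in \<open>auto intro: rev_image_eqI[of i]\<close>)
    qed
    have dj: "(xs, j) \<in> doors n l"
      using d j img lab by (auto simp: doors_def)
    have uniq_i: "i' = i" if "i' \<le> length xs \<and> i' \<noteq> j \<and> ?l i' = ?l j" for i'
      using inj_onD[OF doors_inj_on[OF dj], of i' i] that j i by auto
    have "(SOME i. i \<le> length xs \<and> i \<noteq> j \<and> ?l i = ?l j) = i"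
      using i j by (intro some_equality uniq_i) auto
    then have "twin (xs, j) = (xs, i)"
      by (simp add: twin_def)
    then show "twin p \<in> {(xs, i) \<in> doors n l. \<not> inj_on (chain_labels l xs) {..length xs}} \<and>
        twin (twin p) = p \<and> twin p \<noteq> p"
      using dj ninj j twin_p by (simp add: p)
  qed
qed

text \<open>
  A chain with distinct labels has one label \<open>y\<close> besides the elements of its top \<open>A\<^sub>s\<close>. Since no two
  labels in a chain are complementary, \<open>A\<^sub>s \<union> {y}\<close> is again a sign vector, and it sits on top of the
  whole chain as the one missing member of a longer chain. Conversely, a facet that misses the top of
  its chain is such a chain with distinct labels.
\<close>
lemma card_rainbow_doors:
  assumes mem: "\<And>A. A \<in> sign_vectors n \<Longrightarrow> l A \<in> {- int n..int n}"
    and nocomp: "\<And>A B. A \<in> sign_vectors n \<Longrightarrow> B \<in> sign_vectors n \<Longrightarrow> A \<subseteq> B \<Longrightarrow> l A \<noteq> - l B"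
  shows "card {(xs, i) \<in> doors n l. inj_on (chain_labels l xs) {..length xs}}
       = card {(xs, i) \<in> doors n l. i = length xs \<and> xs \<noteq> []}"
proof (rule bij_betw_same_card[of "\<lambda>(xs, i). (xs @ [chain_labels l xs i], Suc (length xs))"],
    rule bij_betw_imageI)
  let ?R = "{(xs, i) \<in> doors n l. inj_on (chain_labels l xs) {..length xs}}"
  let ?T = "{(xs, i) \<in> doors n l. i = length xs \<and> xs \<noteq> []}"
  let ?f = "\<lambda>(xs, i). (xs @ [chain_labels l xs i], Suc (length xs))"
  show "inj_on ?f ?R"
    by (auto simp: inj_on_def doors_def)
  show "?f ` ?R = ?T"
  proof (intro equalityI subsetI)
    fix q assume "q \<in> ?f ` ?R"
    then obtain xs i where q: "q = (xs @ [chain_labels l xs i], Suc (length xs))"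
      and d: "(xs, i) \<in> doors n l" and inj: "inj_on (chain_labels l xs) {..length xs}"
      by auto
    let ?l = "chain_labels l xs" and ?J = "{..length xs}"
    have i: "i \<le> length xs" and lab: "?l ` (?J - {i}) = set xs"
      and dist: "distinct xs" and sv: "set xs \<in> sign_vectors n"
      using d by (auto simp: doors_def maximal_chains_def)
    have J: "?J = insert i (?J - {i})" using i by auto
    have img: "?l ` ?J = insert (?l i) (set xs)"
      by (subst J) (simp only: image_insert lab)
    have new: "?l i \<notin> set xs"
      using inj J inj_on_insert[of ?l i "?J - {i}"] lab by (metis Diff_idemp)
    have pre: "set (take j xs) \<in> sign_vectors n" for j
      using sv by (rule sign_vectors_subset) (rule set_take_subset)
    have nocomp': "?l a \<noteq> - ?l b" for a b
    proof (cases "a \<le> b")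
      case True
      then show ?thesis
        unfolding chain_labels_def by (intro nocomp pre set_take_subset_set_take)
    next
      case False
      then have "?l b \<noteq> - ?l a"
        unfolding chain_labels_def by (intro nocomp pre set_take_subset_set_take) simp
      then show ?thesis by (metis minus_minus)
    qed
    have "?l ` ?J \<in> sign_vectors n"
    proof -
      have "?l ` ?J \<subseteq> {- int n..int n}"
        unfolding chain_labels_def using mem[OF pre] by blast
      moreover have "- x \<notin> ?l ` ?J" if "x \<in> ?l ` ?J" for x
        using that nocomp' by (metis imageE minus_minus)
      ultimately show ?thesis unfolding sign_vectors_def by blast
    qed
    then have sv': "insert (?l i) (set xs) \<in> sign_vectors n" by (simp only: img)
    have "chain_labels l (xs @ [?l i]) ` ({..Suc (length xs)} - {Suc (length xs)}) = ?l ` ?J"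
      by (rule image_cong) (auto simp: chain_labels_def)
    then show "q \<in> ?T"
      unfolding q using dist sv' new img by (simp add: doors_def maximal_chains_def)
  next
    fix q assume "q \<in> ?T"
    then obtain ys where q: "q = (ys, length ys)" and d: "(ys, length ys) \<in> doors n l" and ne: "ys \<noteq> []"
      by auto
    obtain xs y where ys: "ys = xs @ [y]" using ne by (metis rev_exhaust)
    let ?l = "chain_labels l xs" and ?J = "{..length xs}"
    have dist: "distinct ys" and sv: "set ys \<in> sign_vectors n"
      and lab: "chain_labels l ys ` ({..length ys} - {length ys}) = set ys"
      using d by (auto simp: doors_def maximal_chains_def)
    have "chain_labels l ys ` ({..length ys} - {length ys}) = ?l ` ?J"
      unfolding ys by (rule image_cong) (auto simp: chain_labels_def)
    then have img: "?l ` ?J = insert y (set xs)" using lab ys by simp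
    have inj: "inj_on ?l ?J"
      by (rule eq_card_imp_inj_on) (use img dist ys in \<open>simp_all add: distinct_card\<close>)
    obtain i where i: "i \<le> length xs" "?l i = y" using img by (metis atMost_iff image_iff insertI1)
    have "?l ` (?J - {i}) = ?l ` ?J - {?l i}"
      using inj i by (simp add: inj_on_image_set_diff[OF inj])
    also have "\<dots> = set xs" using img i dist ys by auto
    finally have "(xs, i) \<in> doors n l"
      using i dist sv sign_vectors_subset[OF sv, of "set xs"] ys
      by (auto simp: doors_def maximal_chains_def)
    then have "(xs, i) \<in> ?R" using inj by simp
    moreover have "?f (xs, i) = q" using i ys q by simp
    ultimately show "q \<in> ?f ` ?R" by (metis (no_types, lifting) image_eqI)
  qed
qed

text \<open>
  The doors are counted modulo 2 in two ways. By the missing member, the interior ones and the boundary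
  ones cancel, which leaves the doors without top and the single door of the empty list. By the labels,
  the doors with a repeated label cancel, which leaves the doors with distinct labels, and there are
  exactly as many of these as doors without top.
\<close>
lemma no_complement_free_antipodal_labelling:
  assumes mem: "\<And>A. A \<in> sign_vectors n \<Longrightarrow> l A \<in> {- int n..int n}"
    and odd: "\<And>A. A \<in> sign_vectors n \<Longrightarrow> A \<noteq> {} \<Longrightarrow> l (uminus ` A) = - l A"
    and nocomp: "\<And>A B. A \<in> sign_vectors n \<Longrightarrow> B \<in> sign_vectors n \<Longrightarrow> A \<subseteq> B \<Longrightarrow> l A \<noteq> - l B"
  shows False
proof -
  let ?M = "{(xs, i) \<in> doors n l. 0 < i \<and> i < length xs}"
  let ?B = "{(xs, i) \<in> doors n l. i = 0 \<and> xs \<noteq> []}"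
  let ?T = "{(xs, i) \<in> doors n l. i = length xs \<and> xs \<noteq> []}"
  let ?P = "{(xs, i) \<in> doors n l. \<not> inj_on (chain_labels l xs) {..length xs}}"
  let ?R = "{(xs, i) \<in> doors n l. inj_on (chain_labels l xs) {..length xs}}"
  have fin: "finite ?M" "finite ?B" "finite ?T" "finite ?P" "finite ?R"
    by (rule finite_subset[OF _ finite_doors], auto)+
  \<comment> \<open>This door has no label to match and is the only one missing both the bottom and the top.\<close>
  have "([], 0) \<in> doors n l"
    by (simp add: doors_def maximal_chains_def sign_vectors_def)
  then have "doors n l = insert ([], 0) (?M \<union> ?B \<union> ?T)"
    by (auto simp: doors_def)
  moreover have "([], 0) \<notin> ?M \<union> ?B \<union> ?T" by simp
  moreover have "card (?M \<union> ?B \<union> ?T) = card (?M \<union> ?B) + card ?T"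
    by (rule card_Un_disjoint) (use fin in auto)
  moreover have "card (?M \<union> ?B) = card ?M + card ?B"
    by (rule card_Un_disjoint) (use fin in auto)
  moreover have "finite (?M \<union> ?B \<union> ?T)" using fin by blast
  ultimately have 1: "card (doors n l) = Suc (card ?M + card ?B + card ?T)"
    by (metis (no_types, lifting) card_insert_disjoint)
  have "doors n l = ?P \<union> ?R" by auto
  also have "card \<dots> = card ?P + card ?R"
    by (rule card_Un_disjoint) (use fin in auto)
  finally have 2: "card (doors n l) = card ?P + card ?R" .
  have M: "even (card ?M)" by (rule even_interior_doors)
  have P: "even (card ?P)" by (rule even_repeated_doors)
  have B: "even (card ?B)" using odd by (rule even_boundary_doors)
  have RT: "card ?R = card ?T" using mem nocomp by (rule card_rainbow_doors)
  have parity: False if "Suc (m + b + t) = p + t" "even m" "even b" "even p" for m b t p :: nat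
    using that by presburger
  show False
    by (rule parity[OF trans[OF 1[symmetric] 2[unfolded RT]] M B P])
qed

text \<open>
  If the labels on the boundary avoid \<open>\<plusminus>n\<close>, the centre can be given the label \<open>n\<close> without creating a
  complementary pair, so the parity count applies to the cone over the boundary.
\<close>
theorem octahedral_Tucker:
  assumes bound: "\<And>A. A \<in> sign_vectors n \<Longrightarrow> A \<noteq> {} \<Longrightarrow> l A \<noteq> 0 \<and> \<bar>l A\<bar> < int n"
    and odd: "\<And>A. A \<in> sign_vectors n \<Longrightarrow> A \<noteq> {} \<Longrightarrow> l (uminus ` A) = - l A"
    and n: "n > 0"
  obtains A B where "A \<in> sign_vectors n" "B \<in> sign_vectors n" "A \<noteq> {}" "A \<subseteq> B" "l A = - l B"
proof (rule ccontr)
  assume no: "\<not> thesis"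
  note ex = that
  define l' where "l' A = (if A = {} then int n else l A)" for A
  show False
  proof (rule no_complement_free_antipodal_labelling[of n l'])
    show "l' A \<in> {- int n..int n}" if "A \<in> sign_vectors n" for A
      using bound[OF that] by (cases "A = {}") (auto simp: l'_def abs_less_iff)
    show "l' (uminus ` A) = - l' A" if "A \<in> sign_vectors n" "A \<noteq> {}" for A
      using odd[OF that] that by (simp add: l'_def)
    show "l' A \<noteq> - l' B" if "A \<in> sign_vectors n" "B \<in> sign_vectors n" "A \<subseteq> B" for A B
    proof (cases "A = {}")
      case True
      then show ?thesis using bound[OF that(2)] n by (cases "B = {}") (auto simp: l'_def)
    next
      case False
      then have "l A \<noteq> - l B" using ex[of A B] no that by blast
      moreover have "B \<noteq> {}" using False that by blast
      ultimately show ?thesis using False by (simp add: l'_def)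
    qed
  qed
qed

section \<open>The chromatic number of Kneser graphs\<close>

text \<open>
  Suppose no two disjoint \<open>j\<close>-sets had the same colour. Identify \<open>X\<close> with \<open>{1..n}\<close> and label a sign
  vector with few elements by their number. A sign vector with at least \<open>2 * j - 1\<close> elements has a
  positive or a negative part that contains a \<open>j\<close>-set; it is labelled by the largest colour of these
  \<open>j\<close>-sets, shifted by \<open>2 * j - 1\<close> to avoid the other labels. The sign tells which part has this
  colour, and it is well defined because both parts cannot have it. Growing a sign vector only adds
  \<open>j\<close>-sets to each part, so no complementary labels occur, although all labels are smaller
  than \<open>n\<close>, which contradicts Tucker's lemma.
\<close>
theorem Lovasz_Kneser:
  fixes f :: "'a set \<Rightarrow> 'b"
  assumes finX: "finite X" and j: "j > 0" and finC: "finite C"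
    and f: "f ` nsets X j \<subseteq> C"
    and few: "card C + 2 * j \<le> card X + 1"
  obtains A B where "A \<in> nsets X j" "B \<in> nsets X j" "A \<inter> B = {}" "f A = f B"
proof (rule ccontr)
  note witness = that
  assume no: "\<not> thesis"
  have proper: "f A \<noteq> f B" if "A \<in> nsets X j" "B \<in> nsets X j" "A \<inter> B = {}" for A B
    using witness[OF that] no by blast
  define n where "n = card X"
  have n: "n > 0" using few j by (simp add: n_def)
  obtain e :: "nat \<Rightarrow> 'a" where e: "bij_betw e {1..n} X"
    using ex_bij_betw_nat_finite_1[OF finX] unfolding n_def by blast
  obtain g :: "'b \<Rightarrow> nat" where g: "bij_betw g C {..<card C}"
    using ex_bij_betw_finite_nat[OF finC] unfolding atLeast0LessThan by blast
  define pos where "pos A = (e \<circ> nat) ` {x \<in> A. x > 0}" for A :: "int set"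
  define cols where "cols A = (g \<circ> f) ` nsets (pos A) j" for A
  \<comment> \<open>Taken over both parts, so that antipodal sign vectors have the same value.\<close>
  define top where "top A = Max (cols A \<union> cols (uminus ` A))" for A
  \<comment> \<open>The sign of the coordinate of least index serves to make the labels of small sign vectors antipodal.\<close>
  define low where "low A = Min (abs ` A)" for A :: "int set"
  define l where "l A = (if card A < 2 * j - 1
      then (if low A \<in> A then int (card A) else - int (card A))
      else (if top A \<in> cols A then int (2 * j - 1 + top A) else - int (2 * j - 1 + top A)))" for A
  have inj_e: "inj_on (e \<circ> nat) {1..int n}"
  proof (rule comp_inj_on)
    show "inj_on nat {1..int n}" by (auto simp: inj_on_def)
    show "inj_on e (nat ` {1..int n})"
      by (rule inj_on_subset[OF bij_betw_imp_inj_on[OF e]]) auto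
  qed
  have pos_dom: "{x \<in> A. x > 0} \<subseteq> {1..int n}" if "A \<in> sign_vectors n" for A
    using that by (auto simp: sign_vectors_def)
  have pos_X: "pos A \<subseteq> X" if "A \<in> sign_vectors n" for A
  proof
    fix y assume "y \<in> pos A"
    then obtain x where "x \<in> {x \<in> A. x > 0}" "y = e (nat x)" by (auto simp: pos_def)
    moreover from this have "nat x \<in> {1..n}" using pos_dom[OF that] by auto
    ultimately show "y \<in> X" using bij_betw_apply[OF e] by auto
  qed
  have pos_mono: "pos A \<subseteq> pos B" if "A \<subseteq> B" for A B
    using that by (auto simp: pos_def)
  have cols_mono: "cols A \<subseteq> cols B" if "A \<subseteq> B" for A B
    unfolding cols_def using nsets_mono[OF pos_mono[OF that]] by blast
  have pos_disjoint: "pos A \<inter> pos (uminus ` A) = {}" if A: "A \<in> sign_vectors n" for A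
  proof -
    have disjoint: "{x \<in> A. x > 0} \<inter> {x \<in> uminus ` A. x > 0} = {}"
      using A by (auto simp: sign_vectors_def)
    have "{x \<in> uminus ` A. x > 0} \<subseteq> {1..int n}"
      by (rule pos_dom) (rule sign_vectors_uminus[OF A])
    then have "pos A \<inter> pos (uminus ` A) = (e \<circ> nat) ` ({x \<in> A. x > 0} \<inter> {x \<in> uminus ` A. x > 0})"
      unfolding pos_def by (rule inj_on_image_Int[OF inj_e pos_dom[OF A], symmetric])
    then show ?thesis
      using disjoint by (simp only: image_empty)
  qed
  have cols_C: "cols A \<subseteq> {..<card C}" if "A \<in> sign_vectors n" for A
  proof -
    have "f ` nsets (pos A) j \<subseteq> C" using f nsets_mono[OF pos_X[OF that]] by blast
    then show ?thesis
      unfolding cols_def image_comp[symmetric] using bij_betw_imp_surj_on[OF g] by blast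
  qed
  have cols_disjoint: "cols A \<inter> cols (uminus ` A) = {}" if A: "A \<in> sign_vectors n" for A
  proof (rule ccontr)
    assume "\<not> ?thesis"
    then obtain P N where PN: "P \<in> nsets (pos A) j" "N \<in> nsets (pos (uminus ` A)) j" "g (f P) = g (f N)"
      unfolding cols_def by auto
    have X: "P \<in> nsets X j" "N \<in> nsets X j"
      using PN nsets_mono[OF pos_X[OF A]] nsets_mono[OF pos_X[OF sign_vectors_uminus[OF A]]] by blast+
    then have "f P = f N"
      using PN f bij_betw_imp_inj_on[OF g] by (auto dest: inj_onD)
    moreover have "P \<inter> N = {}"
      using PN pos_disjoint[OF A] by (auto simp: nsets_def)
    ultimately show False using proper X by blast
  qed
  have cols_ex: "cols A \<union> cols (uminus ` A) \<noteq> {}" if A: "A \<in> sign_vectors n" "card A \<ge> 2 * j - 1" for A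
  proof -
    have card_pos: "card (pos B) = card {x \<in> B. x > 0}" if "B \<in> sign_vectors n" for B
      unfolding pos_def by (rule card_image) (rule inj_on_subset[OF inj_e pos_dom[OF that]])
    have fin: "finite A" using A sign_vectors_finite by blast
    have "A \<subseteq> {x \<in> A. x > 0} \<union> uminus ` {x \<in> uminus ` A. x > 0}"
    proof
      fix x assume x: "x \<in> A"
      then have "- x \<noteq> x" using A by (auto simp: sign_vectors_def)
      then have "x > 0 \<or> - x > 0" by linarith
      moreover have "x = - (- x)" "- x \<in> uminus ` A" using x by simp_all
      ultimately show "x \<in> {x \<in> A. x > 0} \<union> uminus ` {x \<in> uminus ` A. x > 0}"
        using x by blast
    qed
    then have "card A \<le> card ({x \<in> A. x > 0} \<union> uminus ` {x \<in> uminus ` A. x > 0})"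
      by (rule card_mono[rotated]) (simp add: fin)
    also have "\<dots> \<le> card {x \<in> A. x > 0} + card {x \<in> uminus ` A. x > 0}"
      by (rule order_trans[OF card_Un_le]) (simp add: card_image)
    finally have "card A \<le> card (pos A) + card (pos (uminus ` A))"
      using card_pos[OF A(1)] card_pos[OF sign_vectors_uminus[OF A(1)]] by simp
    then have "card (pos A) \<ge> j \<or> card (pos (uminus ` A)) \<ge> j"
      using A j by linarith
    moreover have "finite (pos A)" "finite (pos (uminus ` A))"
      using fin by (simp_all add: pos_def)
    ultimately have "nsets (pos A) j \<noteq> {} \<or> nsets (pos (uminus ` A)) j \<noteq> {}"
      by (auto simp: nsets_eq_empty_iff)
    then show ?thesis by (auto simp: cols_def)
  qed
  have top_in: "top A \<in> cols A \<union> cols (uminus ` A)"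
    if "A \<in> sign_vectors n" "card A \<ge> 2 * j - 1" for A
    unfolding top_def
  proof (rule Max_in)
    show "finite (cols A \<union> cols (uminus ` A))"
      using cols_C that sign_vectors_uminus by (meson finite_UnI finite_lessThan finite_subset)
  qed (rule cols_ex[OF that])
  have uminus_uminus: "uminus ` uminus ` A = A" for A :: "int set"
    by (simp add: image_image)
  have top_uminus: "top (uminus ` A) = top A" for A
    by (simp add: top_def uminus_uminus Un_commute)
  have low_in: "low A \<in> A \<longleftrightarrow> - low A \<notin> A" if A: "A \<in> sign_vectors n" "A \<noteq> {}" for A
  proof -
    have "low A \<in> abs ` A"
      unfolding low_def using A sign_vectors_finite by (intro Min_in) auto
    then have "low A \<in> A \<or> - low A \<in> A" by (auto simp: abs_if)
    then show ?thesis using A by (auto simp: sign_vectors_def)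
  qed
  have low_uminus: "low (uminus ` A) = low A" for A
    by (simp add: low_def image_image)
  have card_uminus: "card (uminus ` A) = card A" for A :: "int set"
    by (simp add: card_image)
  have odd: "l (uminus ` A) = - l A" if A: "A \<in> sign_vectors n" "A \<noteq> {}" for A
  proof (cases "card A < 2 * j - 1")
    case True
    have "low A \<in> uminus ` A \<longleftrightarrow> - low A \<in> A" by force
    then show ?thesis
      using True low_in[OF A] by (simp add: l_def card_uminus low_uminus)
  next
    case False
    then have "top A \<in> cols (uminus ` A) \<longleftrightarrow> top A \<notin> cols A"
      using top_in[OF A(1)] cols_disjoint[OF A(1)] by auto
    then show ?thesis
      using False by (simp add: l_def card_uminus top_uminus)
  qed
  have bound: "l A \<noteq> 0 \<and> \<bar>l A\<bar> < int n" if A: "A \<in> sign_vectors n" "A \<noteq> {}" for A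
  proof (cases "card A < 2 * j - 1")
    case True
    have "card A \<noteq> 0" using A sign_vectors_finite by auto
    moreover have "card A < n" using True few by (simp add: n_def)
    ultimately show ?thesis using True by (auto simp: l_def)
  next
    case False
    then have "top A < card C"
      using top_in[OF A(1)] cols_C[OF A(1)] cols_C[OF sign_vectors_uminus[OF A(1)]] by auto
    then have "2 * j - 1 + top A < n" using few j by (simp add: n_def)
    then show ?thesis using False j by (auto simp: l_def)
  qed
  obtain A B where A0: "A \<in> sign_vectors n" and B: "B \<in> sign_vectors n" and ne: "A \<noteq> {}"
    and sub: "A \<subseteq> B" and comp: "l A = - l B"
    using bound odd n by (rule octahedral_Tucker[of n l])
  note A = A0 ne
  have cardAB: "card A \<le> card B" using sub sign_vectors_finite[OF B] by (rule card_mono[rotated])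
  show False
  proof (cases "card B < 2 * j - 1")
    case True
    then have "card A = card B"
      using cardAB comp by (auto simp: l_def split: if_splits)
    then have "A = B" using card_subset_eq[OF sign_vectors_finite[OF B] sub] by simp
    then show False using comp bound[OF A] by simp
  next
    case large: False
    show False
    proof (cases "card A < 2 * j - 1")
      case True
      then show False using large comp j by (auto simp: l_def split: if_splits)
    next
      case False
      then have eq: "top A = top B" and sgn: "top A \<in> cols A \<longleftrightarrow> top B \<notin> cols B"
        using comp large j by (auto simp: l_def split: if_splits)
      have "cols A \<subseteq> cols B" "cols (uminus ` A) \<subseteq> cols (uminus ` B)"
        using sub by (auto intro!: cols_mono)
      then show False
        using eq sgn top_in[OF A(1)] False cols_disjoint[OF B] by auto
    qed
  qed
qed

section \<open>Orientations whose acyclic sets contain no biclique\<close>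

text \<open>
  A fixed pattern on at least \<open>q\<close> elements is met by at most a fraction \<open>2\<^bsup>-q\<^esup>\<close> of all subsets of
  \<open>E\<close>, so fewer than \<open>2\<^sup>q\<close> patterns cannot cover all subsets.
\<close>
lemma exists_set_avoiding_patterns:
  assumes finE: "finite E" and finI: "finite I" and few: "card I < 2 ^ q"
    and U: "\<And>i. i \<in> I \<Longrightarrow> U i \<subseteq> E" and q: "\<And>i. i \<in> I \<Longrightarrow> q \<le> card (U i)"
  obtains T where "T \<subseteq> E" "\<And>i. i \<in> I \<Longrightarrow> T \<inter> U i \<noteq> P i"
proof (cases "I = {}")
  case True
  then show ?thesis using that[of "{}"] by simp
next
  case False
  define bad where "bad i = {T \<in> Pow E. T \<inter> U i = P i}" for i
  have bad: "card (bad i) \<le> 2 ^ (card E - q)" if i: "i \<in> I" for i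
  proof -
    have "inj_on (\<lambda>T. T - U i) (bad i)"
    proof (rule inj_onI)
      fix S T assume "S \<in> bad i" "T \<in> bad i" "S - U i = T - U i"
      then have "S \<inter> U i = T \<inter> U i" "S - U i = T - U i" by (simp_all add: bad_def)
      then show "S = T" by blast
    qed
    moreover have "(\<lambda>T. T - U i) ` bad i \<subseteq> Pow (E - U i)" by (auto simp: bad_def)
    ultimately have "card (bad i) \<le> card (Pow (E - U i))"
      using finE by (intro card_inj_on_le[where f = "\<lambda>T. T - U i"]) auto
    also have "\<dots> = 2 ^ (card E - card (U i))"
      using U[OF i] finE by (simp add: card_Pow card_Diff_subset finite_subset)
    also have "\<dots> \<le> 2 ^ (card E - q)"
      using q[OF i] by (intro power_increasing) auto
    finally show ?thesis .
  qed
  have "q \<le> card E"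
    using False U q card_mono[OF finE] by (meson ex_in_conv order_trans)
  have "card (\<Union>i\<in>I. bad i) \<le> (\<Sum>i\<in>I. card (bad i))" by (rule card_UN_le[OF finI])
  also have "\<dots> \<le> card I * 2 ^ (card E - q)"
    using sum_bounded_above[of I "\<lambda>i. card (bad i)" "2 ^ (card E - q)"] bad by simp
  also have "\<dots> < 2 ^ q * 2 ^ (card E - q)" using few by simp
  also have "\<dots> = card (Pow E)"
    using \<open>q \<le> card E\<close> finE by (simp add: card_Pow flip: power_add)
  finally have less: "card (\<Union>i\<in>I. bad i) < card (Pow E)" .
  have "\<not> Pow E \<subseteq> (\<Union>i\<in>I. bad i)"
  proof
    assume "Pow E \<subseteq> (\<Union>i\<in>I. bad i)"
    moreover have "(\<Union>i\<in>I. bad i) \<subseteq> Pow E" by (auto simp: bad_def)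
    ultimately have "Pow E = (\<Union>i\<in>I. bad i)" by (rule equalityI)
    then show False using less by (metis less_irrefl)
  qed
  then obtain T where "T \<subseteq> E" "T \<notin> (\<Union>i\<in>I. bad i)" by blast
  then show ?thesis by (intro that[of T]) (auto simp: bad_def)
qed

lemma acyclic_topological_order:
  assumes "finite S" "finite r" "acyclic r"
  shows "\<exists>xs. set xs = S \<and> distinct xs \<and> sorted_wrt (\<lambda>x y. (y, x) \<notin> r) xs"
  using assms(1)
proof (induction S rule: finite_psubset_induct)
  case (psubset S)
  show ?case
  proof (cases "S = {}")
    case False
    then obtain z where z: "z \<in> S" "\<And>y. (y, z) \<in> r \<Longrightarrow> y \<notin> S"
      using wfE_min[OF finite_acyclic_wf[OF assms(2,3)]] by (metis ex_in_conv)
    then obtain xs where xs: "set xs = S - {z}" "distinct xs" "sorted_wrt (\<lambda>x y. (y, x) \<notin> r) xs"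
      using psubset.IH[of "S - {z}"] by blast
    then have "set (z # xs) = S \<and> distinct (z # xs) \<and> sorted_wrt (\<lambda>x y. (y, x) \<notin> r) (z # xs)"
      using z by auto
    then show ?thesis by blast
  qed simp
qed

lemma acyclic_vertex_set_arcs:
  assumes "wf_digraph D" "acyclic_vertex_set D S"
  shows "acyclic (arcs_ends (D \<restriction> S))"
proof -
  interpret wf_digraph D by fact
  interpret H: wf_digraph "D \<restriction> S"
    by (rule wellformed_induce_subgraph)
  show ?thesis
  proof (rule acyclicI, rule ccontr)
    assume "\<not> (\<forall>x. (x, x) \<notin> (arcs_ends (D \<restriction> S))\<^sup>+)"
    then obtain x p where "H.awalk x p x" "p \<noteq> []"
      using H.reachable1_awalk by blast
    then have "H.closed_w p" by (auto simp: H.closed_w_def)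
    from H.closed_w_imp_cycle[OF this] show False
      using assms(2) by (auto simp: acyclic_vertex_set_def)
  qed
qed

text \<open>
  For a list of vertices, each marked with one of two sides, these are the arcs of the complete bipartite
  graph between the sides when every edge points from the earlier to the later vertex. An acyclic
  orientation of a complete bipartite graph has this form for any topological order of its vertices, so
  counting marked lists bounds the number of such orientations.
\<close>
definition forward_arcs :: "('a \<times> bool) list \<Rightarrow> 'a rel" where
  "forward_arcs zs = {(fst (zs ! i), fst (zs ! j)) |i j.
     i < j \<and> j < length zs \<and> snd (zs ! i) \<noteq> snd (zs ! j)}"

text \<open>
  Relative to a reference orientation \<open>D\<^sub>0\<close>, an orientation is determined by the set \<open>T\<close> of the arcs
  that it shares with \<open>D\<^sub>0\<close>; this makes the orientations a power set to count in.
\<close>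
lemma orientation_of_subset:
  assumes G: "symmetric (with_proj G)" and D0: "orientation D\<^sub>0 G" and T: "T \<subseteq> parcs D\<^sub>0"
  shows "orientation \<lparr>pverts = pverts G, parcs = T \<union> (parcs D\<^sub>0 - T)\<inverse>\<rparr> G"
proof -
  have sym: "(v, u) \<in> parcs G" if "(u, v) \<in> parcs G" for u v
    using G that by (auto simp: symmetric_def sym_def)
  have xor: "((u, v) \<in> parcs D\<^sub>0) \<noteq> ((v, u) \<in> parcs D\<^sub>0)" if "(u, v) \<in> parcs G" for u v
    using D0 that by (simp add: orientation_def)
  have "T \<union> (parcs D\<^sub>0 - T)\<inverse> \<subseteq> parcs G"
  proof -
    have "parcs D\<^sub>0 \<subseteq> parcs G" using D0 by (simp add: orientation_def)
    then show ?thesis using T sym by blast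
  qed
  moreover have "((u, v) \<in> T \<union> (parcs D\<^sub>0 - T)\<inverse>) \<noteq> ((v, u) \<in> T \<union> (parcs D\<^sub>0 - T)\<inverse>)"
    if "(u, v) \<in> parcs G" for u v
    using xor[OF that] T by blast
  ultimately show ?thesis by (simp add: orientation_def)
qed

text \<open>
  The list is a topological order of the vertices in \<open>A \<union> B\<close>, marked by membership in \<open>A\<close>: an edge
  between the sides cannot point backwards, so it points forwards.
\<close>
lemma acyclic_biclique_forward_arcs:
  assumes G: "pair_graph G" and D: "orientation D G"
    and acyc: "acyclic_vertex_set (with_proj D) S"
    and AS: "A \<subseteq> S" and BS: "B \<subseteq> S" and AB: "A \<times> B \<subseteq> parcs G"
  obtains zs where "length zs = card A + card B" "set zs \<subseteq> pverts G \<times> UNIV"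
    "forward_arcs zs \<subseteq> parcs D" "A \<times> B \<subseteq> forward_arcs zs \<union> (forward_arcs zs)\<inverse>"
proof -
  interpret G: pair_graph G by fact
  have verts: "pverts D = pverts G" and sub: "parcs D \<subseteq> parcs G"
    using D by (auto simp: orientation_def)
  have SV: "S \<subseteq> pverts G" using acyc verts by (simp add: acyclic_vertex_set_def)
  have wf: "wf_digraph (with_proj D)"
    using sub G.in_arcsD1 G.in_arcsD2 verts by unfold_locales auto
  have fin: "finite A" "finite B"
    using AS BS SV G.pair_finite_verts by (meson finite_subset)+
  have disj: "A \<inter> B = {}" using AB G.no_loops' by blast
  let ?r = "parcs D \<inter> S \<times> S"
  have "arcs_ends (with_proj D \<restriction> S) = ?r"
    by (auto simp: arcs_ends_def arc_to_ends_def)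
  then have "acyclic ?r" using acyclic_vertex_set_arcs[OF wf acyc] by simp
  moreover have "finite ?r"
    using sub G.pair_finite_arcs by (meson finite_Int finite_subset)
  ultimately obtain xs where xs: "set xs = A \<union> B" "distinct xs" and
    sorted: "sorted_wrt (\<lambda>x y. (y, x) \<notin> ?r) xs"
    using acyclic_topological_order[of "A \<union> B" ?r] fin by auto
  let ?zs = "map (\<lambda>x. (x, x \<in> A)) xs"
  have arc: "(x, y) \<in> parcs G" "(y, x) \<in> parcs G" if "x \<in> A" "y \<in> B" for x y
    using that AB G.sym_arcs by (auto simp: symmetric_def sym_def)
  have oriented: "(xs ! i, xs ! j) \<in> parcs D"
    if ij: "i < j" "j < length xs" and side: "(xs ! i \<in> A) \<noteq> (xs ! j \<in> A)" for i j
  proof -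
    have mem: "xs ! i \<in> A \<union> B" "xs ! j \<in> A \<union> B" using xs ij by (metis nth_mem order.strict_trans)+
    then have "(xs ! i, xs ! j) \<in> parcs G" using side arc by blast
    then have "(xs ! i, xs ! j) \<in> parcs D \<or> (xs ! j, xs ! i) \<in> parcs D"
      using D by (auto simp: orientation_def)
    moreover have "(xs ! j, xs ! i) \<notin> ?r"
      using sorted ij by (simp add: sorted_wrt_iff_nth_less)
    ultimately show ?thesis using mem AS BS by blast
  qed
  have cross: "(x, y) \<in> forward_arcs ?zs \<union> (forward_arcs ?zs)\<inverse>" if xy: "x \<in> A" "y \<in> B" for x y
  proof -
    obtain i j where i: "i < length xs" "xs ! i = x" and j: "j < length xs" "xs ! j = y"
      using xy xs by (metis Un_iff in_set_conv_nth)
    have "y \<notin> A" using disj xy by blast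
    then have "i \<noteq> j" using i j xy by auto
    then consider "i < j" | "j < i" by linarith
    then show ?thesis
    proof cases
      case 1
      have "(fst (?zs ! i), fst (?zs ! j)) \<in> forward_arcs ?zs"
        unfolding forward_arcs_def using 1 i j xy \<open>y \<notin> A\<close> by force
      then show ?thesis using i j by simp
    next
      case 2
      have "(fst (?zs ! j), fst (?zs ! i)) \<in> forward_arcs ?zs"
        unfolding forward_arcs_def using 2 i j xy \<open>y \<notin> A\<close> by force
      then show ?thesis using i j by simp
    qed
  qed
  show ?thesis
  proof
    show "length ?zs = card A + card B"
      using xs fin disj by (simp flip: distinct_card add: card_Un_disjoint)
    show "set ?zs \<subseteq> pverts G \<times> UNIV" using xs AS BS SV by auto
    show "forward_arcs ?zs \<subseteq> parcs D"
      unfolding forward_arcs_def using oriented by auto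
    show "A \<times> B \<subseteq> forward_arcs ?zs \<union> (forward_arcs ?zs)\<inverse>" using cross by blast
  qed
qed

text \<open>
  For a marked list of \<open>2 * a\<close> vertices, the arcs between the two sides prescribe the direction of at
  least \<open>a * a\<close> edges whenever both sides form a complete bipartite graph with \<open>a\<close> vertices each. There
  are at most \<open>(2 * N)\<^bsup>2 * a\<^esup>\<close> such lists in a graph with \<open>N\<close> vertices, so some orientation realises
  none of them.
\<close>
theorem orientation_with_acyclic_sets_biclique_free:
  assumes G: "pair_graph G" and a: "(2 * card (pverts G)) ^ (2 * a) < 2 ^ (a * a)"
  obtains D where "orientation D G"
    "\<And>S A B. acyclic_vertex_set (with_proj D) S \<Longrightarrow> A \<subseteq> S \<Longrightarrow> B \<subseteq> S \<Longrightarrow>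
       card A = a \<Longrightarrow> card B = a \<Longrightarrow> \<not> A \<times> B \<subseteq> parcs G"
proof -
  interpret G: pair_graph G by fact
  obtain D\<^sub>0 where D0: "orientation D\<^sub>0 G" using ex_orientation[OF G] by blast
  define E where "E = parcs D\<^sub>0"
  have ESub: "E \<subseteq> parcs G" using D0 by (simp add: E_def orientation_def)
  have Exor: "((u, v) \<in> E) \<noteq> ((v, u) \<in> E)" if "(u, v) \<in> parcs G" for u v
    using D0 that by (simp add: E_def orientation_def)
  define Z where "Z = {zs. set zs \<subseteq> pverts G \<times> (UNIV :: bool set) \<and> length zs = 2 * a}"
  define U where "U zs = E \<inter> (forward_arcs zs \<union> (forward_arcs zs)\<inverse>)" for zs
  define I where "I = {zs \<in> Z. a * a \<le> card (U zs)}"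
  have finE: "finite E" using ESub G.pair_finite_arcs by (rule finite_subset)
  have finVB: "finite (pverts G \<times> (UNIV :: bool set))" using G.pair_finite_verts by simp
  have finZ: "finite Z" unfolding Z_def by (rule finite_lists_length_eq[OF finVB])
  have "card I \<le> card Z" by (rule card_mono[OF finZ]) (auto simp: I_def)
  also have "\<dots> = (2 * card (pverts G)) ^ (2 * a)"
    unfolding Z_def by (subst card_lists_length_eq[OF finVB]) (simp add: card_cartesian_product mult.commute)
  finally have few: "card I < 2 ^ (a * a)" using a by simp
  obtain T where TE: "T \<subseteq> E" and T: "\<And>zs. zs \<in> I \<Longrightarrow> T \<inter> U zs \<noteq> E \<inter> forward_arcs zs"
    by (rule exists_set_avoiding_patterns[OF finE _ few, of U "\<lambda>zs. E \<inter> forward_arcs zs"])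
      (use finZ in \<open>auto simp: I_def U_def\<close>)
  define D where "D = \<lparr>pverts = pverts G, parcs = T \<union> (E - T)\<inverse>\<rparr>"
  have D: "orientation D G"
    unfolding D_def E_def by (rule orientation_of_subset[OF G.sym_arcs D0]) (use TE in \<open>simp add: E_def\<close>)
  show ?thesis
  proof (rule that[OF D], rule notI)
    fix S A B assume acyc: "acyclic_vertex_set (with_proj D) S" and AS: "A \<subseteq> S" and BS: "B \<subseteq> S"
      and cA: "card A = a" and cB: "card B = a" and AB: "A \<times> B \<subseteq> parcs G"
    obtain zs where len: "length zs = card A + card B" and set: "set zs \<subseteq> pverts G \<times> UNIV"
      and fwd: "forward_arcs zs \<subseteq> parcs D" and cross: "A \<times> B \<subseteq> forward_arcs zs \<union> (forward_arcs zs)\<inverse>"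
      by (rule acyclic_biclique_forward_arcs[OF G D acyc AS BS AB])
    have finU: "finite (U zs)" using finE by (simp add: U_def)
    have disj: "A \<inter> B = {}" using AB G.no_loops' by blast
    \<comment> \<open>Every edge between the sides is listed in the reference orientation in one of its two directions.\<close>
    let ?h = "\<lambda>(x, y). if (x, y) \<in> E then (x, y) else (y, x)"
    have "?h (x, y) \<in> U zs" if "x \<in> A" "y \<in> B" for x y
    proof -
      have "(x, y) \<in> E \<or> (y, x) \<in> E" using that AB Exor[of x y] by blast
      moreover have "(x, y) \<in> forward_arcs zs \<or> (y, x) \<in> forward_arcs zs" using that cross by blast
      ultimately show ?thesis by (auto simp: U_def)
    qed
    then have "?h ` (A \<times> B) \<subseteq> U zs" by blast
    moreover have "inj_on ?h (A \<times> B)"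
    proof (rule inj_onI)
      fix p q assume "p \<in> A \<times> B" "q \<in> A \<times> B" "?h p = ?h q"
      moreover obtain x y x' y' where "p = (x, y)" "q = (x', y')" by fastforce
      ultimately show "p = q" using disj by (cases "p \<in> E"; cases "q \<in> E") auto
    qed
    ultimately have "card (A \<times> B) \<le> card (U zs)"
      using finU by (intro card_inj_on_le)
    then have "zs \<in> I"
      using len set cA cB by (simp add: I_def Z_def card_cartesian_product)
    moreover have "T \<inter> U zs = E \<inter> forward_arcs zs"
    proof -
      have fwd': "(u, v) \<in> T \<or> (v, u) \<in> E - T" if "(u, v) \<in> forward_arcs zs" for u v
        using that fwd by (auto simp: D_def)
      have anti: "(v, u) \<notin> E" if "(u, v) \<in> E" for u v
        using that Exor ESub by blast
      have 1: "(u, v) \<in> T" if "(u, v) \<in> E" "(u, v) \<in> forward_arcs zs" for u v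
        using fwd'[OF that(2)] anti[OF that(1)] by blast
      have 2: "(u, v) \<notin> T" if "(u, v) \<in> E" "(v, u) \<in> forward_arcs zs" for u v
        using fwd'[OF that(2)] anti[OF that(1)] TE by blast
      show ?thesis using 1 2 TE unfolding U_def by (intro equalityI subrelI) blast+
    qed
    ultimately show False using T by blast
  qed
qed

section \<open>Estimates\<close>

text \<open>
  The number \<open>k\<^sup>k / k!\<close> is one term of the series of \<open>e\<^sup>k\<close>.
\<close>
lemma power_self_le_fact: "real k ^ k \<le> 3 ^ k * fact k"
proof -
  have "real k ^ k / fact k \<le> exp (real k)"
    using sum_le_suminf[of "\<lambda>i. real k ^ i /\<^sub>R fact i" "{k}"] summable_exp_generic[of "real k"]
    by (simp add: exp_def divide_inverse mult.commute)
  also have "\<dots> = exp 1 ^ k" by (simp flip: exp_of_nat_mult)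
  also have "\<dots> \<le> 3 ^ k" by (intro power_mono exp_le) simp
  finally show ?thesis by (simp add: field_simps)
qed

lemma log2_3_le: "log 2 3 \<le> (8 / 5 :: real)"
proof -
  have "5 * log 2 3 = log 2 (3 ^ 5 :: real)" by (subst log_nat_power) simp_all
  also have "\<dots> \<le> log 2 (2 ^ 8)" by (subst log_le_cancel_iff) simp_all
  also have "\<dots> = 8" by (subst log_nat_power) simp_all
  finally show ?thesis by simp
qed

lemma log2_binomial_le:
  assumes "k > 0" "k \<le> n"
  shows "log 2 (n choose k) \<le> k * (log 2 (n / k) + 8 / 5)"
proof -
  have "real (n choose k) * fact k \<le> real n ^ k"
    using binomial_fact_pow[of n k] by (metis of_nat_fact of_nat_le_iff of_nat_mult of_nat_power)
  then have upper: "3 ^ k * (real (n choose k) * fact k) \<le> 3 ^ k * real n ^ k"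
    by (rule mult_left_mono) simp
  have "real (n choose k) * real k ^ k \<le> real (n choose k) * (3 ^ k * fact k)"
    by (rule mult_left_mono[OF power_self_le_fact]) simp
  also have "\<dots> = 3 ^ k * (real (n choose k) * fact k)" by simp
  also note upper
  also have "3 ^ k * real n ^ k = (3 * real n) ^ k" by (simp add: power_mult_distrib)
  finally have "real (n choose k) \<le> (3 * (n / k)) ^ k"
    using assms by (simp add: field_simps power_mult_distrib power_divide)
  then have "log 2 (n choose k) \<le> log 2 ((3 * (n / k)) ^ k)"
    using assms by (subst log_le_cancel_iff) auto
  also have "\<dots> = k * (log 2 (n / k) + log 2 3)"
    using assms log_mult[of 2 3 "n / k"] by (simp add: log_nat_power)
  also have "\<dots> \<le> k * (log 2 (n / k) + 8 / 5)"
    using log2_3_le by (intro mult_left_mono) auto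
  finally show ?thesis .
qed

lemma choose_2_le_choose:
  assumes "k \<ge> 2" "m \<ge> 2"
  shows "(k + m) choose 2 \<le> (k + m) choose k"
proof (cases "k \<le> m")
  case True
  then show ?thesis using assms by (intro binomial_mono) auto
next
  case False
  then have "(k + m) choose 2 \<le> (k + m) choose m"
    using assms by (intro binomial_mono) auto
  also have "\<dots> = (k + m) choose k" by (subst binomial_symmetric) auto
  finally show ?thesis .
qed

text \<open>
  The hypothesis on \<open>c\<close> gives roughly \<open>c * L \<le> s / 8\<close>, and that on \<open>m\<close> gives roughly
  \<open>m \<ge> 7 * s / 16\<close>. As \<open>log 2 (n choose k)\<close> is at most \<open>k * (L + 8 / 5)\<close>, the left-hand side is
  of order \<open>k * m\<close>, and for \<open>k \<ge> 2\<close> already the binomial coefficient \<open>(k + m) choose 2\<close> exceeds it. For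
  \<open>k = 1\<close> the right-hand side is only \<open>m + 1\<close>; there \<open>L = log 2 n\<close> is at least 4, so that the terms
  of the left-hand side without the factor \<open>L\<close> are absorbed.
\<close>
lemma cover_size_times_log_less_choose:
  fixes n k c m :: nat
  defines "s \<equiv> real n - 2 * real k + 2" and "L \<equiv> log 2 (real n / real k)"
  assumes k: "k > 0" and nk: "n \<ge> 2 * k" and c: "c > 0"
    and cs: "(real c + 1) * (8 * L) \<le> s" and m: "s - 2 - real c \<le> 2 * real m"
  shows "real c * (2 * log 2 (n choose k) + 2) < real ((k + m) choose k)"
proof -
  have "2 \<le> real n / real k" using k nk by (simp add: field_simps flip: of_nat_mult)
  then have L: "1 \<le> L" unfolding L_def using k nk by (subst le_log_iff) auto
  have cL: "real c \<le> real c * L" using L by (simp add: mult_le_cancel_left1)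
  have "real c * (2 * log 2 (n choose k) + 2) \<le> real c * (2 * (k * (L + 8 / 5)) + 2)"
    unfolding L_def using k nk by (intro mult_left_mono add_right_mono log2_binomial_le) auto
  also have "\<dots> < real ((k + m) choose k)"
  proof (cases "k = 1")
    case True
    have "2 * (8 * L) \<le> (real c + 1) * (8 * L)"
      using c L by (intro mult_right_mono) auto
    moreover have "s = real n" using True by (simp add: s_def)
    ultimately have "16 * L \<le> real n" using cs by linarith
    then have "16 \<le> real n" using L by linarith
    then have "log 2 (2 ^ 4) \<le> L" unfolding L_def True by (subst log_le_cancel_iff) auto
    then have "4 \<le> L" by (subst (asm) log_nat_power) auto
    then have "real c * 4 \<le> real c * L" by (intro mult_left_mono) auto
    moreover have "(real c + 1) * (8 * L) = 8 * (real c * L) + 8 * L" by (simp add: algebra_simps)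
    ultimately have "2 * (real c * L) + 26 / 5 * real c < real m + 1"
      using cs m \<open>4 \<le> L\<close> c by linarith
    moreover have "real c * (2 * (L + 8 / 5) + 2) = 2 * (real c * L) + 26 / 5 * real c"
      by (simp add: algebra_simps)
    ultimately have "real c * (2 * (L + 8 / 5) + 2) < real m + 1" by simp
    then show ?thesis using True by simp
  next
    case False
    then have k2: "k \<ge> 2" using k by simp
    define x where "x = s / 8 - 1"
    have cLx: "real c * L \<le> x" using cs L by (simp add: x_def algebra_simps)
    have x: "7 * x + 6 \<le> 2 * real m" using m cLx cL by (simp add: x_def)
    have "m \<ge> 2" using x cLx cL c by linarith
    have "real c * (2 * (k * (L + 8 / 5)) + 2) = 2 * k * (real c * L) + (16 / 5 * k + 2) * real c"
      by (simp add: algebra_simps)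
    also have "\<dots> \<le> 2 * k * x + (16 / 5 * k + 2) * x"
      using cLx cL by (intro add_mono mult_left_mono) auto
    also have "\<dots> = x * (26 / 5 * k + 2)" by (simp add: algebra_simps)
    also have "\<dots> \<le> (2 * real m - 6) / 7 * (26 / 5 * k + 2)"
      using x by (intro mult_right_mono) auto
    also have "\<dots> < (real k + real m) * (real k + real m - 1) / 2"
    proof -
      let ?u = "(2 * real m - 6) * (26 / 5 * k + 2)" and ?v = "(real k + real m) * (real k + real m - 1)"
      \<comment> \<open>Positivity of the difference as a quadratic polynomial in \<open>k\<close> and \<open>m\<close>, by completing squares.\<close>
      have "7 * ?v - 2 * ?u = 17 / 5 * (real k - real m)\<^sup>2 + 18 / 5 * (real k)\<^sup>2
          + 18 / 5 * (real m - 25 / 12)\<^sup>2 + 277 / 5 * real k + 67 / 8"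
        by (simp add: power2_eq_square field_simps)
      also have "\<dots> > 0" by (intro add_nonneg_pos add_nonneg_nonneg) auto
      finally have pos: "0 < 7 * ?v - 2 * ?u" .
      have "u / 7 < v / 2" if "0 < 7 * v - 2 * u" for u v :: real
        using that by linarith
      from this[OF pos] have "?u / 7 < ?v / 2" .
      then show ?thesis by simp
    qed
    also have "\<dots> = real ((k + m) choose 2)"
    proof -
      have "even ((k + m) * (k + m - 1))" using k by (cases "k + m") auto
      then have "2 * ((k + m) choose 2) = (k + m) * (k + m - 1)"
        by (simp only: choose_two dvd_mult_div_cancel)
      then have "2 * real ((k + m) choose 2) = real (k + m) * real (k + m - 1)"
        by (metis of_nat_mult of_nat_numeral)
      also have "real (k + m - 1) = real k + real m - 1" using k by (simp add: of_nat_diff)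
      finally show ?thesis by simp
    qed
    also have "\<dots> \<le> real ((k + m) choose k)"
      using choose_2_le_choose[OF k2 \<open>m \<ge> 2\<close>] by simp
    finally show ?thesis .
  qed
  finally show ?thesis .
qed

lemma power_less_power_square:
  assumes "N > 0" "2 * log 2 (real N) + 2 < real a"
  shows "(2 * N) ^ (2 * a) < (2::nat) ^ (a * a)"
proof -
  have "a > 0"
  proof -
    have "0 \<le> log 2 (real N)" using assms(1) by simp
    then show ?thesis using assms(2) by linarith
  qed
  have "log 2 (real ((2 * N) ^ (2 * a))) = real a * (2 * log 2 (real N) + 2)"
    using assms(1) by (simp add: log_nat_power log_mult algebra_simps)
  also have "\<dots> < real a * real a" using \<open>a > 0\<close> assms(2) by simp
  also have "\<dots> = log 2 (real (2 ^ (a * a)))" by (simp add: log_nat_power)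
  finally have "real ((2 * N) ^ (2 * a)) < real (2 ^ (a * a))"
    using assms(1) by (subst (asm) log_less_cancel_iff) auto
  then show ?thesis by (simp only: of_nat_less_iff)
qed

section \<open>Covers of Kneser graphs\<close>

text \<open>
  By the pigeonhole principle every \<open>(k + m)\<close>-set \<open>Y\<close> has at least \<open>a\<close> of its \<open>k\<close>-subsets in one
  member of the cover; choose it as the colour of \<open>Y\<close>. With so few colours, two disjoint
  \<open>(k + m)\<close>-sets share their colour, and \<open>k\<close>-subsets of one are disjoint from \<open>k\<close>-subsets of the other.
\<close>
theorem kneser_cover_contains_biclique:
  fixes X :: "'a set"
  assumes X: "finite X" and k: "k > 0" and fin: "finite \<S>" and cover: "nsets X k \<subseteq> \<Union>\<S>"
    and few: "card \<S> + 2 * (k + m) \<le> card X + 1"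
    and large: "card \<S> * (a - 1) < (k + m) choose k"
  obtains S A B where "S \<in> \<S>" "A \<subseteq> S" "B \<subseteq> S" "card A = a" "card B = a"
    "A \<times> B \<subseteq> parcs (kneser_graph X k)"
proof -
  have "\<exists>S\<in>\<S>. a \<le> card (nsets Y k \<inter> S)" if Y: "Y \<in> nsets X (k + m)" for Y
  proof (rule ccontr)
    assume "\<not> ?thesis"
    then have small: "card (nsets Y k \<inter> S) \<le> a - 1" if "S \<in> \<S>" for S
      using that by fastforce
    have Y': "finite Y" "card Y = k + m" "Y \<subseteq> X" using Y by (auto simp: nsets_def)
    have "nsets Y k = (\<Union>S\<in>\<S>. nsets Y k \<inter> S)"
      using cover nsets_mono[OF Y'(3)] by blast
    then have "card (nsets Y k) \<le> (\<Sum>S\<in>\<S>. card (nsets Y k \<inter> S))"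
      by (metis card_UN_le[OF fin])
    also have "\<dots> \<le> card \<S> * (a - 1)"
      using sum_bounded_above[of \<S> "\<lambda>S. card (nsets Y k \<inter> S)"] small by simp
    finally show False using large Y' by (simp)
  qed
  then obtain g where g: "\<And>Y. Y \<in> nsets X (k + m) \<Longrightarrow> g Y \<in> \<S> \<and> a \<le> card (nsets Y k \<inter> g Y)"
    by metis
  have "g ` nsets X (k + m) \<subseteq> \<S>" using g by blast
  then obtain Y Z where Y: "Y \<in> nsets X (k + m)" and Z: "Z \<in> nsets X (k + m)"
    and disj: "Y \<inter> Z = {}" and eq: "g Y = g Z"
    using Lovasz_Kneser[OF X _ fin _ few, of g] k by (metis add_gr_0)
  obtain A where A: "A \<subseteq> nsets Y k \<inter> g Y" "card A = a"
    using g[OF Y] by (metis obtain_subset_with_card_n)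
  obtain B where B: "B \<subseteq> nsets Z k \<inter> g Z" "card B = a"
    using g[OF Z] by (metis obtain_subset_with_card_n)
  show ?thesis
  proof
    show "g Y \<in> \<S>" using g Y by blast
    show "A \<subseteq> g Y" "B \<subseteq> g Y" using A B eq by auto
    show "A \<times> B \<subseteq> parcs (kneser_graph X k)"
    proof (rule subrelI)
      fix P Q assume "(P, Q) \<in> A \<times> B"
      then have PQ: "P \<in> nsets Y k" "Q \<in> nsets Z k" using A B by auto
      moreover have "Y \<subseteq> X" "Z \<subseteq> X" using Y Z by (simp_all add: nsets_def)
      ultimately have "P \<in> nsets X k" "Q \<in> nsets X k" using nsets_mono by blast+
      moreover have "P \<inter> Q = {}" using PQ disj by (auto simp: nsets_def)
      ultimately show "(P, Q) \<in> parcs (kneser_graph X k)" by (simp add: kneser_graph_def)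
    qed
  qed (use A B in auto)
qed

theorem theorem3p5:
  fixes n k :: nat and X :: "'a set"
  assumes "n > 0" and "k > 0" and "n \<ge> 2 * k"
    and "finite X" and "card X = n"
  shows "int (dichromatic_number (kneser_graph X k))
           \<ge> \<lfloor>(real n - 2 * real k + 2) / (8 * log 2 (real n / real k))\<rfloor>"
proof (rule ccontr)
  define L where "L = log 2 (real n / real k)"
  define N where "N = n choose k"
  \<comment> \<open>The least size, up to rounding, at which the counting argument excludes acyclic bicliques.\<close>
  define a where "a = nat \<lfloor>2 * log 2 (real N)\<rfloor> + 3"
  let ?G = "kneser_graph X k"
  assume "\<not> ?thesis"
  then have less: "int (dichromatic_number ?G) < \<lfloor>(real n - 2 * real k + 2) / (8 * L)\<rfloor>"
    by (simp add: L_def)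
  have G: "pair_graph ?G" using assms by (intro pair_graph_kneser_graph)
  have N: "N > 0" using assms by (simp add: N_def)
  have "2 \<le> real n / real k" using assms by (simp add: field_simps flip: of_nat_mult)
  then have L: "1 \<le> L" unfolding L_def using assms by (subst le_log_iff) auto
  have logN: "0 \<le> log 2 (real N)" using N by simp
  have a: "2 * log 2 (real N) + 2 < real a" "real (a - 1) \<le> 2 * log 2 (real N) + 2"
    using logN unfolding a_def by linarith+
  have cardV: "card (pverts ?G) = N"
    using assms by (simp add: kneser_graph_def N_def)
  obtain D where D: "orientation D ?G" and biclique_free:
    "\<And>S A B. acyclic_vertex_set (with_proj D) S \<Longrightarrow> A \<subseteq> S \<Longrightarrow> B \<subseteq> S \<Longrightarrow>
       card A = a \<Longrightarrow> card B = a \<Longrightarrow> \<not> A \<times> B \<subseteq> parcs ?G"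
    using orientation_with_acyclic_sets_biclique_free[OF G, of a] power_less_power_square[OF N a(1)]
    unfolding cardV by blast
  interpret G: pair_graph ?G by (rule G)
  have verts: "pverts D = pverts ?G" and arcs: "parcs D \<subseteq> parcs ?G"
    using D by (auto simp: orientation_def)
  have "loopfree_digraph (with_proj D)"
    using arcs G.in_arcsD1 G.in_arcsD2 G.no_loops' verts by unfold_locales auto
  moreover have "finite (verts (with_proj D))" using verts G.pair_finite_verts by simp
  ultimately obtain \<S> where fin: "finite \<S>" and card: "card \<S> = digraph_chromatic_number (with_proj D)"
    and acyc: "\<And>S. S \<in> \<S> \<Longrightarrow> acyclic_vertex_set (with_proj D) S"
    and cover: "\<Union>\<S> = verts (with_proj D)"
    using digraph_chromatic_number_attained by blast
  have coverX: "\<Union>\<S> = nsets X k" using cover verts by (simp add: kneser_graph_def)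
  define c where "c = card \<S>"
  have "c \<le> dichromatic_number ?G"
    unfolding c_def card dichromatic_number_def
    using finite_orientations[OF G] D by (intro Max_ge) auto
  then have "int c + 1 \<le> \<lfloor>(real n - 2 * real k + 2) / (8 * L)\<rfloor>" using less by linarith
  then have "real c + 1 \<le> (real n - 2 * real k + 2) / (8 * L)" by (simp add: le_floor_iff)
  then have cL: "(real c + 1) * (8 * L) \<le> real n - 2 * real k + 2"
    using L by (simp add: field_simps)
  have "\<S> \<noteq> {}"
  proof
    assume "\<S> = {}"
    then have "card (nsets X k) = 0" using coverX by simp
    then show False using N assms by (simp add: N_def)
  qed
  then have c: "c > 0" using fin by (simp add: c_def card_gt_0_iff)
  have "(real c + 1) * 8 \<le> (real c + 1) * (8 * L)" using L by (intro mult_left_mono) auto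
  then have "(real c + 1) * 8 \<le> real n - 2 * real k + 2" using cL by linarith
  then have "real (8 * c + 8 + 2 * k) \<le> real (n + 2)" by simp
  then have c_le: "8 * c + 8 + 2 * k \<le> n + 2" by (simp only: of_nat_le_iff)
  \<comment> \<open>The largest \<open>m\<close> for which \<open>(k + m)\<close>-sets still need more than \<open>c\<close> colours.\<close>
  define d where "d = n + 1 - 2 * k - c"
  define m where "m = d div 2"
  have d: "d + c + 2 * k = n + 1" using c_le assms(3) unfolding d_def by linarith
  have few: "c + 2 * (k + m) \<le> n + 1" and "n \<le> 2 * m + c + 2 * k"
  proof -
    have "2 * m \<le> d" "d \<le> 2 * m + 1" unfolding m_def by simp_all
    then show "c + 2 * (k + m) \<le> n + 1" "n \<le> 2 * m + c + 2 * k" using d by simp_all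
  qed
  then have m: "real n - 2 * real k + 2 - 2 - real c \<le> 2 * real m" by linarith
  have "real c * (2 * log 2 (real N) + 2) < real ((k + m) choose k)"
    unfolding N_def using cover_size_times_log_less_choose[OF assms(2,3) c cL[unfolded L_def] m] .
  moreover have "real c * real (a - 1) \<le> real c * (2 * log 2 (real N) + 2)"
    using a(2) by (intro mult_left_mono) auto
  ultimately have "real (c * (a - 1)) < real ((k + m) choose k)" by simp
  then have large: "c * (a - 1) < (k + m) choose k" by (simp only: of_nat_less_iff)
  obtain S A B where "S \<in> \<S>" "A \<subseteq> S" "B \<subseteq> S" "card A = a" "card B = a" "A \<times> B \<subseteq> parcs ?G"
    by (rule kneser_cover_contains_biclique[of X k \<S> m a])
      (use assms fin coverX few large in \<open>simp_all add: c_def\<close>)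
  then show False using biclique_free acyc by blast
qed

end
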